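(* Let $s$ and $t$ be positive integers with $t>2^{2s}-2s-1$. Then there exists a $K_{s,t}$-intersecting family of graphs $\mathcal{F}$ on $n$ vertices with $$|\mathcal{F}|>2^{\binom{n}{2}-st}.$$
   Context: A family of graphs on $n$ vertices is a set $\mathcal{G}\subseteq 2^{\binom{[n]}{2}}$ of labelled graphs on the vertex set $[n]=\{1,\dots,n\}$ (each graph identified with its edge set). For two such graphs, $G_1\cap G_2$ is the graph on $[n]$ with edge set $E(G_1)\cap E(G_2)$. Given a fixed unlabelled graph $H$, the family $\mathcal{G}$ is $H$-intersecting if for every pair $G_1,G_2\in\mathcal{G}$ the graph $G_1\cap G_2$ contains a copy of $H$ (as a not necessarily induced subgraph). $K_{s,t}$ is the complete bipartite graph with parts of sizes $s$ and $t$. *)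

theory Defs
  imports Complex_Main "HOL-Library.Ramsey"
begin

text \<open>A simple graph is a pair of a vertex set and a set of two-element subsets of it; an
  unlabelled graph is given by any representative. A labelled graph on \<open>{1..n}\<close> is
  identified with its edge set, a subset of \<^term>\<open>nsets {1..n} 2\<close>.\<close>

type_synonym 'a graph = "'a set \<times> 'a set set"

definition graph_family :: "nat \<Rightarrow> nat set set set \<Rightarrow> bool" where
  "graph_family n \<F> \<longleftrightarrow> \<F> \<subseteq> Pow (nsets {1..n} 2)"

text \<open>The copy need not be induced: the embedding only has to preserve edges.\<close>

definition contains_copy :: "'b graph \<Rightarrow> 'a graph \<Rightarrow> bool" where
  "contains_copy G H \<longleftrightarrow>
     (\<exists>f. inj_on f (fst H) \<and> f ` fst H \<subseteq> fst G \<and> (\<forall>e\<in>snd H. f ` e \<in> snd G))"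

text \<open>The two graphs of a pair are not required to be distinct.\<close>

definition H_intersecting :: "nat \<Rightarrow> 'a graph \<Rightarrow> nat set set set \<Rightarrow> bool" where
  "H_intersecting n H \<F> \<longleftrightarrow>
     (\<forall>G1\<in>\<F>. \<forall>G2\<in>\<F>. contains_copy ({1..n}, G1 \<inter> G2) H)"

definition complete_bipartite :: "nat \<Rightarrow> nat \<Rightarrow> (nat + nat) graph" where
  "complete_bipartite s t =
     (Inl ` {..<s} \<union> Inr ` {..<t}, {{Inl i, Inr j} | i j. i < s \<and> j < t})"

end

theory Submission
  imports Defs "HOL-Library.Disjoint_Sets"
begin

text \<open>The construction is Frankl's \<open>t\<close>-intersecting family "at least \<open>t + 1\<close> out of
  \<open>t + 2\<close>", applied to stars instead of points. Fix disjoint vertex sets \<open>A\<close> and \<open>B\<close> of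
  sizes \<open>s\<close> and \<open>t + 2\<close>, and call \<open>b \<in> B\<close> full in a graph if it is joined to all of \<open>A\<close>. Take
  all graphs in which at most one vertex of \<open>B\<close> is not full. Two such graphs share at least
  \<open>t\<close> full vertices, which together with \<open>A\<close> span a copy of \<open>K\<^bsub>s,t\<^esub>\<close> in the intersection
  (\<open>contains_copy_complete_bipartite\<close>).

  In a uniformly random graph the vertices of \<open>B\<close> are full independently, each with
  probability \<open>p = 2 powr (- s)\<close>. The family therefore has density
  \<open>(t + 2) p ^ (t + 1) (1 - p) + p ^ (t + 2)\<close>, an instance of the count
  \<open>card_supersets_all_but_one_block\<close>. For \<open>p < 1\<close> this exceeds \<open>p ^ t\<close>, the density of
  all supergraphs of a fixed \<open>K\<^bsub>s,t\<^esub>\<close>, exactly when \<open>(t + 1) p > 1\<close>, that is, when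
  \<open>t \<ge> 2 ^ s\<close>. The hypothesis gives this because \<open>2 s + 2 ^ s \<le> 2 ^ (2 s)\<close> for
  all natural numbers \<open>s \<ge> 1\<close>.\<close>

lemma card_supersets:
  assumes "finite E" "S \<subseteq> E"
  shows "card {G. G \<subseteq> E \<and> S \<subseteq> G} = 2 ^ (card E - card S)"
proof -
  have "bij_betw (\<lambda>X. X \<union> S) (Pow (E - S)) {G. G \<subseteq> E \<and> S \<subseteq> G}"
    by (rule bij_betw_byWitness[where f' = "\<lambda>G. G - S"]) (use assms in auto)
  then have "card {G. G \<subseteq> E \<and> S \<subseteq> G} = card (Pow (E - S))"
    by (simp add: bij_betw_same_card)
  also have "\<dots> = 2 ^ (card E - card S)"
    using assms by (simp add: card_Pow card_Diff_subset finite_subset)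
  finally show ?thesis .
qed

lemma card_UN_equal_blocks:
  assumes "finite C" "disjoint_family_on K C"
    and "\<And>c. c \<in> C \<Longrightarrow> finite (K c)" "\<And>c. c \<in> C \<Longrightarrow> card (K c) = s"
  shows "card (\<Union>(K ` C)) = s * card C"
  using assms by (simp add: card_UN_disjoint' mult.commute)

text \<open>The sets counted here split according to the block that they fail to contain, if any: no
  two blocks can be missing, so the classes are disjoint. The common factor
  \<open>2 ^ (card E - s * card B)\<close> is the number of choices outside the blocks. Inside them,
  either every block is contained, or one of the \<open>card B\<close> blocks is replaced by one of its
  \<open>2 ^ s - 1\<close> proper subsets.\<close>

lemma card_supersets_all_but_one_block:
  fixes K :: "'b \<Rightarrow> 'a set"
  assumes "finite E" "finite B" "B \<noteq> {}"
    and sub: "\<And>b. b \<in> B \<Longrightarrow> K b \<subseteq> E"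
    and disj: "disjoint_family_on K B"
    and size: "\<And>b. b \<in> B \<Longrightarrow> card (K b) = s"
  shows "card {G. G \<subseteq> E \<and> (\<exists>b\<in>B. \<forall>c\<in>B - {b}. K c \<subseteq> G)}
    = 2 ^ (card E - s * card B) * (card B * (2 ^ s - 1) + 1)"
proof -
  define q :: nat where "q = 2 ^ (card E - s * card B)"
  define All where "All = {G. G \<subseteq> E \<and> \<Union>(K ` B) \<subseteq> G}"
  define But where "But b = {G. G \<subseteq> E \<and> \<Union>(K ` (B - {b})) \<subseteq> G}" for b
  have fin: "finite All" "finite (But b)" for b
    using \<open>finite E\<close> unfolding All_def But_def by (auto intro: finite_subset[of _ "Pow E"])
  have card_blocks: "card (\<Union>(K ` C)) = s * card C" if "C \<subseteq> B" for C
  proof (rule card_UN_equal_blocks)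
    show "finite C" using finite_subset[OF that \<open>finite B\<close>] .
    show "disjoint_family_on K C" using disjoint_family_on_mono[OF that disj] .
    show "finite (K c)" if "c \<in> C" for c
      using finite_subset[OF sub \<open>finite E\<close>] that \<open>C \<subseteq> B\<close> by blast
    show "card (K c) = s" if "c \<in> C" for c
      using size that \<open>C \<subseteq> B\<close> by (meson subsetD)
  qed
  have le: "s * card B \<le> card E"
    using card_blocks[of B] sub \<open>finite E\<close> card_mono[of E "\<Union>(K ` B)"] by fastforce
  have card_All: "card All = q"
    unfolding All_def q_def using sub card_blocks[of B]
    by (subst card_supersets[OF \<open>finite E\<close>]) auto
  have card_But: "card (But b - All) = q * (2 ^ s - 1)" if "b \<in> B" for b
  proof -
    have "card B > 0" using \<open>finite B\<close> that card_gt_0_iff by blast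
    then have "s * card B = s * (card B - 1) + s"
      by (cases "card B") auto
    then have "card E - s * (card B - 1) = (card E - s * card B) + s"
      using le by linarith
    moreover have "card (But b) = 2 ^ (card E - s * (card B - 1))"
      unfolding But_def using sub card_blocks[of "B - {b}"] that \<open>finite B\<close>
      by (subst card_supersets[OF \<open>finite E\<close>]) auto
    ultimately have "card (But b) = q * 2 ^ s"
      by (simp add: q_def power_add)
    moreover have "All \<subseteq> But b" unfolding All_def But_def by auto
    ultimately show ?thesis
      using card_All fin by (simp add: card_Diff_subset diff_mult_distrib2)
  qed
  have "{G. G \<subseteq> E \<and> (\<exists>b\<in>B. \<forall>c\<in>B - {b}. K c \<subseteq> G)}
      = (\<Union>b\<in>B. But b - All) \<union> All"
    using \<open>B \<noteq> {}\<close> unfolding All_def But_def by blast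
  moreover have "card ((\<Union>b\<in>B. But b - All) \<union> All) = card (\<Union>b\<in>B. But b - All) + card All"
    using fin \<open>finite B\<close> by (intro card_Un_disjoint) auto
  moreover have "card (\<Union>b\<in>B. But b - All) = (\<Sum>b\<in>B. card (But b - All))"
  proof (rule card_UN_disjoint)
    show "\<forall>b\<in>B. \<forall>c\<in>B. b \<noteq> c \<longrightarrow> (But b - All) \<inter> (But c - All) = {}"
      unfolding All_def But_def by blast
  qed (use \<open>finite B\<close> fin in auto)
  moreover have "(\<Sum>b\<in>B. card (But b - All)) = card B * (q * (2 ^ s - 1))"
    using card_But by simp
  ultimately show ?thesis
    using card_All by (simp add: q_def algebra_simps)
qed

lemma contains_copy_complete_bipartite:
  assumes "finite A" "finite C" "A \<inter> C = {}" "A \<subseteq> V" "C \<subseteq> V"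
    and "s \<le> card A" "t \<le> card C"
    and edges: "\<And>a c. a \<in> A \<Longrightarrow> c \<in> C \<Longrightarrow> {a, c} \<in> G"
  shows "contains_copy (V, G) (complete_bipartite s t)"
proof -
  obtain g where g: "g ` {..<s} \<subseteq> A" "inj_on g {..<s}"
    using card_le_inj[of "{..<s}" A] assms by auto
  obtain h where h: "h ` {..<t} \<subseteq> C" "inj_on h {..<t}"
    using card_le_inj[of "{..<t}" C] assms by auto
  have "inj_on (case_sum g h) (Inl ` {..<s} \<union> Inr ` {..<t})"
    using g h \<open>A \<inter> C = {}\<close> by (auto simp: inj_on_def) blast+
  moreover have "case_sum g h ` (Inl ` {..<s} \<union> Inr ` {..<t}) \<subseteq> V"
    using g(1) h(1) \<open>A \<subseteq> V\<close> \<open>C \<subseteq> V\<close> by (auto simp: image_subset_iff subset_iff)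
  ultimately show ?thesis
    unfolding contains_copy_def complete_bipartite_def using g(1) h(1) edges
    by (intro exI[of _ "case_sum g h"]) (auto simp: image_subset_iff)
qed

lemma two_mult_add_power_le:
  fixes s :: nat
  assumes "s > 0"
  shows "2 * s + 2 ^ s \<le> 2 ^ (2 * s)"
proof -
  have "s + 1 \<le> 2 ^ s" using less_exp[of s] by linarith
  moreover have "2 \<le> (2::nat) ^ s" using assms by (cases s) auto
  ultimately have "2 * s + 2 ^ s \<le> 2 ^ s * s + (2 ^ s :: nat)"
    by simp
  also have "\<dots> = 2 ^ s * (s + 1)" by simp
  also have "\<dots> \<le> 2 ^ s * 2 ^ s" using \<open>s + 1 \<le> 2 ^ s\<close> by (rule mult_le_mono2)
  finally show ?thesis by (simp add: mult_2 power_add)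
qed

theorem theorem11:
  fixes s t :: nat
  assumes "s > 0" and "t > 0"
    and "int t > 2 ^ (2 * s) - 2 * int s - 1"
  shows "\<exists>N. \<forall>n\<ge>N. \<exists>\<F>. graph_family n \<F> \<and>
           H_intersecting n (complete_bipartite s t) \<F> \<and>
           real (card \<F>) > 2 powr (real (n choose 2) - real (s * t))"
proof (intro exI[of _ "s + t + 2"] allI impI)
  fix n assume n: "s + t + 2 \<le> n"
  define E where "E = nsets {1..n} 2"
  define A where "A = {1..s}"
  define B where "B = {s + 1..s + t + 2}"
  define K where "K b = (\<lambda>a. {a, b}) ` A" for b
  define \<F> where "\<F> = {G. G \<subseteq> E \<and> (\<exists>b\<in>B. \<forall>c\<in>B - {b}. K c \<subseteq> G)}"
  have AB: "finite A" "finite B" "card A = s" "card B = t + 2" "A \<inter> B = {}"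
    "A \<subseteq> {1..n}" "B \<subseteq> {1..n}"
    using n by (auto simp: A_def B_def)
  have E: "finite E" "card E = n choose 2"
    unfolding E_def by (simp_all add: finite_imp_finite_nsets card_nsets)

  have family: "graph_family n \<F>"
    by (auto simp: graph_family_def \<F>_def E_def)

  have intersecting: "H_intersecting n (complete_bipartite s t) \<F>"
    unfolding H_intersecting_def
  proof (intro ballI)
    fix G1 G2 assume "G1 \<in> \<F>" "G2 \<in> \<F>"
    then obtain b1 b2 where b: "\<forall>c\<in>B - {b1}. K c \<subseteq> G1" "\<forall>c\<in>B - {b2}. K c \<subseteq> G2"
      unfolding \<F>_def by auto
    show "contains_copy ({1..n}, G1 \<inter> G2) (complete_bipartite s t)"
    proof (rule contains_copy_complete_bipartite[of A "B - {b1, b2}"])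
      have "card {b1, b2} \<le> 2" by (simp add: card_insert_if)
      then show "t \<le> card (B - {b1, b2})"
        using diff_card_le_card_Diff[of "{b1, b2}" B] AB by simp
      show "{a, c} \<in> G1 \<inter> G2" if "a \<in> A" "c \<in> B - {b1, b2}" for a c
        using that b unfolding K_def by blast
    qed (use AB in auto)
  qed

  define M :: nat where "M = 2 ^ s"
  define q :: nat where "q = 2 ^ (card E - s * (t + 2))"
  have sub: "K b \<subseteq> E" if "b \<in> B" for b
    using that n unfolding K_def E_def A_def B_def by (auto simp: nsets_def card_insert_if)
  have disj: "disjoint_family_on K B"
    using AB unfolding disjoint_family_on_def K_def by (auto simp: doubleton_eq_iff)
  have size: "card (K b) = s" if "b \<in> B" for b
  proof -
    have "inj_on (\<lambda>a. {a, b}) A" by (auto simp: inj_on_def doubleton_eq_iff)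
    then show ?thesis using AB by (simp add: K_def card_image)
  qed
  have card_F: "card \<F> = q * ((t + 2) * (M - 1) + 1)"
    using card_supersets_all_but_one_block[OF E(1) AB(2) _ sub disj size] AB
    unfolding \<F>_def q_def M_def by fastforce

  have "M \<le> t"
  proof -
    have "2 ^ (2 * s) \<le> t + 2 * s"
      using assms(3) by (simp flip: of_nat_le_iff[where 'a = int])
    then show ?thesis using two_mult_add_power_le[OF assms(1)] unfolding M_def by linarith
  qed
  have "M \<ge> 2" using assms(1) unfolding M_def by (cases s) auto
  have "M * M < (t + 2) * (M - 1) + 1"
  proof -
    obtain m where m: "M = Suc m" "m > 0" using \<open>M \<ge> 2\<close> by (cases M) auto
    have "M * M = (m + 2) * m + 1" using m by simp
    also have "\<dots> < (t + 2) * m + 1" using m \<open>M \<le> t\<close> by simp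
    finally show ?thesis using m by simp
  qed
  moreover have "q > 0" unfolding q_def by simp
  ultimately have large: "q * (M * M) < card \<F>"
    unfolding card_F by (rule mult_strict_left_mono)

  \<comment> \<open>The blocks fit into \<open>E\<close>, so the exponent in \<open>q\<close> is a genuine difference.\<close>
  have "card (\<Union>(K ` B)) = s * card B"
    using AB(2) disj finite_subset[OF sub E(1)] size by (rule card_UN_equal_blocks)
  moreover have "card (\<Union>(K ` B)) \<le> card E"
    using E(1) by (rule card_mono) (use sub in blast)
  ultimately have "s * t + s + s \<le> card E"
    using AB(4) by (simp add: distrib_left)
  then have "card E - s * t = (card E - s * (t + 2)) + s + s" and le: "s * t \<le> card E"
    by (simp_all add: distrib_left)
  moreover have "q * (M * M) = 2 ^ (card E - s * (t + 2) + s + s)"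
    unfolding q_def M_def by (simp only: power_add mult.assoc)
  ultimately have "q * (M * M) = 2 ^ (card E - s * t)"
    by metis
  then have pow: "2 ^ (card E - s * t) < card \<F>"
    using large by (simp only:)
  have "real (n choose 2) - real (s * t) = real (card E - s * t)"
    unfolding E(2)[symmetric] using le by (rule of_nat_diff[symmetric])
  then have "2 powr (real (n choose 2) - real (s * t)) = real (2 ^ (card E - s * t))"
    by (simp only: powr_realpow of_nat_power of_nat_numeral zero_less_numeral)
  also have "\<dots> < real (card \<F>)"
    using pow by (rule of_nat_less_iff[THEN iffD2])
  finally have "real (card \<F>) > 2 powr (real (n choose 2) - real (s * t))" .
  with family intersecting
  show "\<exists>\<F>. graph_family n \<F> \<and> H_intersecting n (complete_bipartite s t) \<F> \<and>
      real (card \<F>) > 2 powr (real (n choose 2) - real (s * t))"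
    by (intro exI[of _ \<F>] conjI)
qed

end
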